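(* Let $d\ge 1$, let $X\subset\mathbb{R}^d$ be convex and bounded, let $f^*:X\to\mathbb{R}$ be convex and differentiable, and let $X_d=\{x_0,\dots,x_d\}\subset X$ be a set of $d+1$ points with convex hull $\mathcal{C}(X_d)$. Suppose that the point of interest $x^*=0$ lies in the interior of $\mathcal{C}(X_d)$. Define $$A=\{v\in\mathbb{R}^d : v\cdot x_i\le \nabla f^*(x_i)\cdot x_i,\ i=0,\dots,d\}.$$ Then $A$ is a bounded polyhedron with $d+1$ faces, defined by the hyperplanes $$F_i=\{v\in\mathbb{R}^d : v\cdot x_i=\nabla f^*(x_i)\cdot x_i\},\qquad i=0,\dots,d,$$ and with vertices $v_i=\bigcap_{j\ne i}F_j$, $i=0,\dots,d$.
   Context: $\cdot$ denotes the Euclidean inner product on $\mathbb{R}^d$, and $\nabla f^*$ is the gradient of $f^*$. The notation $v_i=\bigcap_{j\neq i}F_j$ means that the intersection of the $d$ hyperplanes $F_j$, $j\in\{0,\dots,d\}\setminus\{i\}$, is a single point, and $v_i\in\mathbb{R}^d$ is that point. The word "faces" refers to the bounding hyperplanes $F_0,\dots,F_d$, indexed by $i$; that $v_0,\dots,v_d$ are the vertices means that $A$ is the polyhedron (convex hull) determined by the points $v_0,\dots,v_d$. The set $A$ is called the set of feasible gradients at the point of interest $x^*=0$. *)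

theory Defs
  imports "HOL-Analysis.Analysis"
begin

text \<open>
  The gradient of \<open>f\<close> relative to \<open>X\<close>. The derivative is taken within \<open>X\<close>, because \<open>f\<close> is a function
  on \<open>X\<close> and \<open>X\<close> need not be open. When \<open>X\<close> is convex with nonempty interior, such a gradient is
  unique on all of \<open>X\<close>. On an open \<open>X\<close> this is \<open>GDERIV f y :> g y\<close> for all \<open>y \<in> X\<close>.
\<close>
definition is_gradient_on :: "('a::real_inner \<Rightarrow> real) \<Rightarrow> ('a \<Rightarrow> 'a) \<Rightarrow> 'a set \<Rightarrow> bool" where
  "is_gradient_on f g X \<longleftrightarrow> (\<forall>y\<in>X. (f has_derivative (\<lambda>h. h \<bullet> g y)) (at y within X))"

definition hyperplane :: "'a::real_inner set \<Rightarrow> bool" where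
  "hyperplane H \<longleftrightarrow> (\<exists>a b. a \<noteq> 0 \<and> H = {v. v \<bullet> a = b})"

definition feasible_gradients :: "('a::real_inner \<Rightarrow> 'a) \<Rightarrow> (nat \<Rightarrow> 'a) \<Rightarrow> nat set \<Rightarrow> 'a set" where
  "feasible_gradients g x I = {v. \<forall>i\<in>I. v \<bullet> x i \<le> g (x i) \<bullet> x i}"

definition feasible_face :: "('a::real_inner \<Rightarrow> 'a) \<Rightarrow> (nat \<Rightarrow> 'a) \<Rightarrow> nat \<Rightarrow> 'a set" where
  "feasible_face g x i = {v. v \<bullet> x i = g (x i) \<bullet> x i}"

text \<open>
  \<open>A\<close> is the set cut out by the inequalities with indices in \<open>I\<close>, each of the hyperplanes bounds \<open>A\<close>
  (it meets \<open>A\<close> in a nonempty face), and none of the inequalities can be dropped.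
  The hyperplanes are counted by index: if \<open>f\<close> is affine, then \<open>A\<close> is a single point, and in
  dimension one the two hyperplanes even coincide. Hence no claim is made that the faces
  \<open>A \<inter> F i\<close> have codimension one.
\<close>
definition bounded_by_faces :: "('a::real_inner \<Rightarrow> 'a) \<Rightarrow> (nat \<Rightarrow> 'a) \<Rightarrow> nat set \<Rightarrow> 'a set \<Rightarrow> bool" where
  "bounded_by_faces g x I A \<longleftrightarrow>
     A = feasible_gradients g x I \<and>
     (\<forall>i\<in>I. hyperplane (feasible_face g x i) \<and>
            A \<inter> feasible_face g x i \<noteq> {} \<and>
            (A \<inter> feasible_face g x i) face_of A \<and>
            feasible_gradients g x (I - {i}) \<noteq> A)"

end

theory Submission
  imports Defs
begin

text \<open>
  Since \<open>0\<close> is interior to the simplex spanned by the points \<open>x i\<close>, it is a combination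
  \<open>0 = (\<Sum>i. \<lambda> i *\<^sub>R x i)\<close> with all weights positive, and any \<open>d\<close> of the points form a basis.
  Hence the \<open>d\<close> equations \<open>v \<bullet> x j = b j\<close>, \<open>j \<noteq> i\<close>, where \<open>b j\<close> is the inner product of the
  gradient at \<open>x j\<close> with \<open>x j\<close>, have a unique solution, the vertex \<open>v i\<close>.

  Pairing the relation between the points with any \<open>v\<close> gives \<open>(\<Sum>j. \<lambda> j * (v \<bullet> x j)) = 0\<close>, so the
  weighted slacks \<open>\<lambda> j * (b j - v \<bullet> x j)\<close> always add up to the same number \<open>s = (\<Sum>j. \<lambda> j * b j)\<close>.
  At \<open>v i\<close> only the \<open>i\<close>-th slack can be nonzero, so it equals \<open>s / \<lambda> i\<close>. Everything therefore
  depends on the sign of \<open>s\<close>. If \<open>s > 0\<close>, the numbers \<open>\<lambda> j * (b j - v \<bullet> x j) / s\<close> are the barycentric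
  coordinates of \<open>v\<close> with respect to the vertices, and the feasible points are those at which they
  are nonnegative (lemma \<open>halfspaces_eq_convex_hull_vertex\<close>). If \<open>s = 0\<close>, all vertices coincide
  and are the only feasible point.

  That \<open>s \<ge> 0\<close> is where convexity enters: the tangent inequality between \<open>x i\<close> and \<open>0\<close> reads
  \<open>b i \<ge> f (x i) - f 0\<close>, and the weighted mean of the right-hand sides is nonnegative by Jensen's
  inequality (lemma \<open>weighted_gradient_sum_nonneg\<close>).
\<close>

section \<open>Convex functions and their gradients\<close>

text \<open>
  The base point may lie on the boundary of the domain, so the argument uses only the restriction
  of the function to the segment from \<open>y\<close> to \<open>z\<close>: its difference quotients at \<open>y\<close> are bounded by
  \<open>f z - f y\<close>, and so is their limit.
\<close>
lemma convex_on_ge_tangent_within: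
  fixes f :: "'a::real_inner \<Rightarrow> real"
  assumes conv: "convex_on X f" and X: "convex X" and y: "y \<in> X" and z: "z \<in> X"
    and der: "(f has_derivative (\<lambda>h. h \<bullet> g)) (at y within X)"
  shows "f y + (z - y) \<bullet> g \<le> f z"
proof -
  define p where "p = (\<lambda>t::real. y + t *\<^sub>R (z - y))"
  define \<phi> where "\<phi> = (\<lambda>t. f (p t))"
  have p_alt: "p t = (1 - t) *\<^sub>R y + t *\<^sub>R z" for t
    by (simp add: p_def algebra_simps)
  have p_in: "p ` {0..1} \<subseteq> X"
    using X y z by (auto simp: p_alt intro!: convexD)
  have "(p has_derivative (\<lambda>t. t *\<^sub>R (z - y))) (at 0 within {0..1})"
    unfolding p_def by (auto intro!: derivative_eq_intros)
  moreover have "(f has_derivative (\<lambda>h. h \<bullet> g)) (at (p 0) within p ` {0..1})"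
    using has_derivative_subset[OF der p_in] by (simp add: p_def)
  ultimately have "(\<phi> has_derivative (\<lambda>t. t *\<^sub>R (z - y) \<bullet> g)) (at 0 within {0..1})"
    unfolding \<phi>_def by (rule has_derivative_in_compose)
  then have "(\<phi> has_field_derivative (z - y) \<bullet> g) (at 0 within {0..1})"
    by (simp add: has_field_derivative_def mult_commute_abs)
  then have lim: "((\<lambda>t. (\<phi> t - \<phi> 0) / t) \<longlongrightarrow> (z - y) \<bullet> g) (at 0 within {0..1})"
    by (simp add: has_field_derivative_iff)
  have "(\<phi> t - \<phi> 0) / t \<le> f z - f y" if t: "0 < t" "t \<le> 1" for t
  proof -
    have "\<phi> t \<le> (1 - t) * f y + t * f z"
      using convex_onD[OF conv, of t y z] t y z by (simp add: \<phi>_def p_alt)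
    then show ?thesis
      using t by (simp add: \<phi>_def p_def field_simps)
  qed
  then have "eventually (\<lambda>t. (\<phi> t - \<phi> 0) / t \<le> f z - f y) (at 0 within {0..1})"
    by (auto simp: eventually_at_filter)
  moreover have "at (0::real) within {0..1} \<noteq> bot"
    by (simp add: at_within_Icc_at_right)
  ultimately have "(z - y) \<bullet> g \<le> f z - f y"
    using lim tendsto_upperbound by blast
  then show ?thesis by simp
qed

text \<open>
  The tangent at each \<open>x i\<close>, evaluated at \<open>0\<close>, lies below \<open>f 0\<close>, and Jensen's inequality bounds
  \<open>f 0\<close> by the mean of the values \<open>f (x i)\<close>, because \<open>0\<close> is the corresponding mean of the points.
\<close>
lemma weighted_gradient_sum_nonneg:
  fixes f :: "'a::real_inner \<Rightarrow> real" and x :: "'i \<Rightarrow> 'a"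
  assumes conv: "convex_on X f" and X: "convex X" and grad: "is_gradient_on f grad X"
    and fin: "finite I" and xX: "x ` I \<subseteq> X"
    and lam: "\<And>i. i \<in> I \<Longrightarrow> 0 \<le> lam i" "sum lam I = 1" "(\<Sum>i\<in>I. lam i *\<^sub>R x i) = 0"
  shows "0 \<le> (\<Sum>i\<in>I. lam i * (grad (x i) \<bullet> x i))"
proof -
  have ne: "I \<noteq> {}"
    using lam(2) by auto
  have zero: "0 \<in> X"
    using convex_sum[OF fin X lam(2,1), of x] xX by (simp add: lam(3) image_subset_iff)
  have "f 0 \<le> (\<Sum>i\<in>I. lam i * f (x i))"
    using convex_on_sum[OF fin ne conv lam(2,1), of x] xX by (simp add: lam(3) image_subset_iff)
  then have "0 \<le> (\<Sum>i\<in>I. lam i * f (x i)) - (\<Sum>i\<in>I. lam i) * f 0"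
    by (simp add: lam(2))
  also have "\<dots> = (\<Sum>i\<in>I. lam i * (f (x i) - f 0))"
    by (simp add: sum_distrib_right right_diff_distrib sum_subtractf)
  also have "\<dots> \<le> (\<Sum>i\<in>I. lam i * (grad (x i) \<bullet> x i))"
  proof (intro sum_mono mult_left_mono lam(1))
    fix i assume "i \<in> I"
    then have xi: "x i \<in> X"
      using xX by auto
    have "(f has_derivative (\<lambda>h. h \<bullet> grad (x i))) (at (x i) within X)"
      using grad xi by (simp add: is_gradient_on_def)
    from convex_on_ge_tangent_within[OF conv X xi zero this]
    show "f (x i) - f 0 \<le> grad (x i) \<bullet> x i"
      by (simp add: inner_commute)
  qed
  finally show ?thesis .
qed

section \<open>Families of vectors surrounding the origin\<close>

text \<open>
  These are the vertex families of simplices with the origin in their interior (lemma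
  \<open>surrounding_family_if_zero_interior\<close>), up to rescaling the weights. The weights enter only
  through a linear relation, so their sum is left arbitrary.
\<close>
locale surrounding_family =
  fixes I :: "'i set" and x :: "'i \<Rightarrow> 'a::euclidean_space" and lam :: "'i \<Rightarrow> real"
  assumes fin: "finite I"
    and card_eq: "card I = DIM('a) + 1"
    and lam_pos: "i \<in> I \<Longrightarrow> 0 < lam i"
    and relation: "(\<Sum>i\<in>I. lam i *\<^sub>R x i) = 0"
    and spanning: "span (x ` I) = UNIV"
begin

text \<open>The relation expresses \<open>x i\<close> by the other vectors, because its coefficient is nonzero.\<close>
lemma span_remove:
  assumes i: "i \<in> I"
  shows "span (x ` (I - {i})) = UNIV"
proof -
  have "lam i *\<^sub>R x i = - (\<Sum>j\<in>I - {i}. lam j *\<^sub>R x j)"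
    using relation by (simp add: sum.remove[OF fin i] eq_neg_iff_add_eq_0)
  then have "x i = inverse (lam i) *\<^sub>R (- (\<Sum>j\<in>I - {i}. lam j *\<^sub>R x j))"
    using lam_pos[OF i] by (metis less_irrefl scaleR_scaleR left_inverse scaleR_one)
  moreover have "inverse (lam i) *\<^sub>R (- (\<Sum>j\<in>I - {i}. lam j *\<^sub>R x j)) \<in> span (x ` (I - {i}))"
    by (intro span_scale span_neg span_sum) (auto intro: span_base)
  ultimately have "x i \<in> span (x ` (I - {i}))"
    by simp
  then have "x ` I \<subseteq> span (x ` (I - {i}))"
    by (auto intro: span_base)
  then have "span (x ` I) \<subseteq> span (x ` (I - {i}))"
    by (simp add: span_minimal)
  then show ?thesis
    using spanning by auto
qed

text \<open>Only \<open>DIM('a)\<close> indices remain, too few to span the space with a repetition or a dependency.\<close>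
lemma basis_remove:
  assumes i: "i \<in> I"
  shows "independent (x ` (I - {i}))" and "inj_on x (I - {i})"
proof -
  have card: "card (I - {i}) = DIM('a)"
    using card_eq i fin by simp
  have le: "card (x ` (I - {i})) \<le> DIM('a)"
    using card card_image_le[of "I - {i}" x] fin by simp
  show "independent (x ` (I - {i}))"
    using card_le_dim_spanning[of "x ` (I - {i})" UNIV] span_remove[OF i] fin le
    by simp
  have "DIM('a) \<le> card (x ` (I - {i}))"
    using dim_le_card[of UNIV "x ` (I - {i})"] span_remove[OF i] fin by simp
  with le card show "inj_on x (I - {i})"
    using fin by (intro eq_card_imp_inj_on) auto
qed

lemma nonzero:
  assumes i: "i \<in> I"
  shows "x i \<noteq> 0"
proof -
  have "card I \<ge> 2"
    using card_eq DIM_positive[where 'a = 'a] by simp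
  then obtain j where "j \<in> I" "j \<noteq> i"
    by (metis card_le_Suc0_iff_eq fin not_less_eq_eq numeral_2_eq_2)
  then show ?thesis
    using basis_remove(1)[of j] i dependent_zero[of "x ` (I - {j})"] by (metis DiffI image_eqI singletonD)
qed

lemma inner_eq_imp_eq:
  assumes i: "i \<in> I" and eq: "\<And>j. j \<in> I - {i} \<Longrightarrow> v \<bullet> x j = w \<bullet> x j"
  shows "v = w"
proof -
  have "orthogonal (v - w) (v - w)"
  proof (rule orthogonal_to_span)
    show "v - w \<in> span (x ` (I - {i}))"
      by (simp add: span_remove[OF i])
    show "orthogonal (v - w) y" if "y \<in> x ` (I - {i})" for y
      using that eq by (auto simp: orthogonal_def inner_diff_left)
  qed
  then show ?thesis by (simp add: orthogonal_def)
qed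

lemma ex1_inner_eq:
  assumes i: "i \<in> I"
  shows "\<exists>!v. \<forall>j\<in>I - {i}. v \<bullet> x j = b j"
proof -
  obtain h where h: "linear h" "\<forall>y\<in>x ` (I - {i}). h y = b (inv_into (I - {i}) x y)"
    using linear_independent_extend[OF basis_remove(1)[OF i],
        of "\<lambda>y. b (inv_into (I - {i}) x y)"] by (elim exE conjE)
  \<comment> \<open>the vector that represents the linear functional \<open>h\<close>\<close>
  define v where "v = adjoint h 1"
  have v: "v \<bullet> x j = b j" if "j \<in> I - {i}" for j
  proof -
    have "v \<bullet> x j = h (x j)"
      by (simp add: v_def adjoint_clauses(2)[OF h(1)])
    also have "\<dots> = b (inv_into (I - {i}) x (x j))"
      using h(2) that by blast
    also have "\<dots> = b j"
      by (simp only: inv_into_f_f[OF basis_remove(2)[OF i] that])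
    finally show ?thesis .
  qed
  show ?thesis
  proof (rule ex1I)
    show "\<forall>j\<in>I - {i}. v \<bullet> x j = b j"
      using v by blast
    show "w = v" if "\<forall>j\<in>I - {i}. w \<bullet> x j = b j" for w
      by (rule inner_eq_imp_eq[OF i]) (use that v in simp)
  qed
qed

definition vertex :: "('i \<Rightarrow> real) \<Rightarrow> 'i \<Rightarrow> 'a" where
  "vertex b i = (THE v. \<forall>j\<in>I - {i}. v \<bullet> x j = b j)"

lemma inner_vertex:
  assumes "i \<in> I" "j \<in> I" "j \<noteq> i"
  shows "vertex b i \<bullet> x j = b j"
  using theI'[OF ex1_inner_eq[OF assms(1), of b]] assms by (simp add: vertex_def)

lemma Inter_hyperplanes_eq_vertex:
  assumes i: "i \<in> I"
  shows "(\<Inter>j\<in>I - {i}. {v. v \<bullet> x j = b j}) = {vertex b i}"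
proof -
  have "v = vertex b i" if "\<forall>j\<in>I - {i}. v \<bullet> x j = b j" for v
    using that inner_vertex[OF i] by (intro inner_eq_imp_eq[OF i]) simp
  then show ?thesis
    using inner_vertex[OF i] by auto
qed

text \<open>The relation between the vectors, paired with an arbitrary vector.\<close>
lemma weighted_inner_sum: "(\<Sum>j\<in>I. lam j * (v \<bullet> x j)) = 0"
proof -
  have "(\<Sum>j\<in>I. lam j * (v \<bullet> x j)) = v \<bullet> (\<Sum>j\<in>I. lam j *\<^sub>R x j)"
    by (simp add: inner_sum_right)
  then show ?thesis by (simp add: relation)
qed

lemma weighted_slack_sum:
  "(\<Sum>j\<in>I. lam j * (b j - v \<bullet> x j)) = (\<Sum>j\<in>I. lam j * b j)"
  by (simp add: right_diff_distrib sum_subtractf weighted_inner_sum)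

text \<open>The \<open>i\<close>-th vertex has no slack in the other inequalities, so the \<open>i\<close>-th takes the whole sum.\<close>
lemma inner_vertex_self:
  assumes i: "i \<in> I"
  shows "vertex b i \<bullet> x i = b i - (\<Sum>j\<in>I. lam j * b j) / lam i"
proof -
  have "(\<Sum>j\<in>I - {i}. lam j * (b j - vertex b i \<bullet> x j)) = 0"
    by (simp add: inner_vertex[OF i])
  then have "lam i * (b i - vertex b i \<bullet> x i) = (\<Sum>j\<in>I. lam j * b j)"
    using weighted_slack_sum[of b "vertex b i"] by (simp add: sum.remove[OF fin i])
  then show ?thesis
    using lam_pos[OF i] by (simp add: field_simps)
qed

lemma vertex_feasible:
  assumes s: "0 \<le> (\<Sum>j\<in>I. lam j * b j)" and i: "i \<in> I" and k: "k \<in> I"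
  shows "vertex b i \<bullet> x k \<le> b k"
  using s lam_pos[OF i] by (cases "k = i") (simp_all add: inner_vertex inner_vertex_self i k)

text \<open>
  The weighted slacks of a feasible \<open>v\<close>, divided by their sum, are its coordinates with respect to
  the vertices. If the sum is zero, this normalisation is impossible, but then all slacks vanish
  and \<open>v\<close> is itself each of the vertices.
\<close>
theorem halfspaces_eq_convex_hull_vertex:
  assumes s: "0 \<le> (\<Sum>j\<in>I. lam j * b j)"
  shows "{v. \<forall>i\<in>I. v \<bullet> x i \<le> b i} = convex hull (vertex b ` I)" (is "?P = _")
proof
  have "?P = (\<Inter>i\<in>I. {v. x i \<bullet> v \<le> b i})"
    by (auto simp: inner_commute)
  then have "convex ?P"
    by (simp add: convex_INT convex_halfspace_le)
  then show "convex hull (vertex b ` I) \<subseteq> ?P"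
    using vertex_feasible[OF s] by (intro hull_minimal) auto
next
  define s where "s = (\<Sum>j\<in>I. lam j * b j)"
  obtain i where i: "i \<in> I"
    using card_eq by fastforce
  show "?P \<subseteq> convex hull (vertex b ` I)"
  proof
    fix v assume v: "v \<in> ?P"
    define c where "c = (\<lambda>j. lam j * (b j - v \<bullet> x j))"
    have c_nonneg: "0 \<le> c j" if "j \<in> I" for j
      using v that lam_pos[OF that] by (simp add: c_def)
    have c_sum: "sum c I = s"
      by (simp add: c_def s_def weighted_slack_sum)
    show "v \<in> convex hull (vertex b ` I)"
    proof (cases "s = 0")
      case True
      then have "c j = 0" if "j \<in> I" for j
        using c_sum c_nonneg that sum_nonneg_eq_0_iff[OF fin, of c] by auto
      then have "v \<bullet> x j = b j" if "j \<in> I" for j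
        using that lam_pos[OF that] by (fastforce simp: c_def)
      then have "v = vertex b i"
        using inner_vertex[OF i] by (intro inner_eq_imp_eq[OF i]) auto
      then show ?thesis
        using i by (auto intro: hull_inc)
    next
      case False
      then have s_pos: "0 < s"
        using s by (simp add: s_def)
      define w where "w = (\<Sum>j\<in>I. (c j / s) *\<^sub>R vertex b j)"
      have weights: "(\<Sum>j\<in>I. c j / s) = 1"
        using c_sum s_pos by (simp add: sum_divide_distrib[symmetric])
      have "w \<bullet> x k = v \<bullet> x k" if k: "k \<in> I" for k
      proof -
        have "w \<bullet> x k = (\<Sum>j\<in>I. c j / s * (vertex b j \<bullet> x k))"
          by (simp add: w_def inner_sum_left)
        also have "\<dots> = (\<Sum>j\<in>I. c j / s * b k - (if j = k then c k / lam k else 0))"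
          using s_pos k by (intro sum.cong)
            (auto simp: inner_vertex inner_vertex_self right_diff_distrib diff_divide_distrib s_def)
        also have "\<dots> = b k - c k / lam k"
          using weights k fin
          by (simp add: sum_subtractf sum_distrib_right[symmetric] del: times_divide_eq_left)
        also have "\<dots> = v \<bullet> x k"
          using lam_pos[OF k] by (simp add: c_def)
        finally show ?thesis .
      qed
      then have "w = v"
        by (intro inner_eq_imp_eq[OF i]) auto
      moreover have "w \<in> convex hull (vertex b ` I)"
        unfolding w_def using fin weights c_nonneg s_pos
        by (intro convex_sum convex_convex_hull) (auto intro: hull_inc)
      ultimately show ?thesis by simp
    qed
  qed
qed

text \<open>
  Lowering all right-hand sides but the \<open>i\<close>-th moves the \<open>i\<close>-th vertex outwards: the slacks of the
  other inequalities grow, so the \<open>i\<close>-th one must become negative to keep the weighted sum constant.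
\<close>
lemma halfspace_irredundant:
  assumes i: "i \<in> I"
  shows "\<exists>v. (\<forall>j\<in>I - {i}. v \<bullet> x j \<le> b j) \<and> b i < v \<bullet> x i"
proof -
  define s where "s = (\<Sum>j\<in>I. lam j * b j)"
  define L where "L = sum lam (I - {i})"
  have "card (I - {i}) = DIM('a)"
    using card_eq i fin by simp
  then have "I - {i} \<noteq> {}"
    using DIM_positive[where 'a = 'a] by (metis card.empty less_irrefl)
  then have L: "0 < L"
    unfolding L_def using fin lam_pos by (intro sum_pos) auto
  \<comment> \<open>chosen so that the other weighted slacks add up to \<open>K * L\<close>, which exceeds \<open>s\<close>\<close>
  define K where "K = (\<bar>s\<bar> + 1) / L"
  obtain v where v: "\<And>j. j \<in> I - {i} \<Longrightarrow> v \<bullet> x j = b j - K"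
    using ex1_inner_eq[OF i, of "\<lambda>j. b j - K"] by blast
  have "(\<Sum>j\<in>I - {i}. lam j * (b j - v \<bullet> x j)) = (\<Sum>j\<in>I - {i}. lam j * K)"
    using v by (intro sum.cong) auto
  also have "\<dots> = L * K"
    by (simp add: L_def sum_distrib_right)
  also have "\<dots> = \<bar>s\<bar> + 1"
    using L by (simp add: K_def)
  finally have "lam i * (b i - v \<bullet> x i) + (\<bar>s\<bar> + 1) = s"
    using weighted_slack_sum[of b v] by (simp add: s_def sum.remove[OF fin i])
  then have "lam i * (b i - v \<bullet> x i) < 0"
    by linarith
  then have "b i < v \<bullet> x i"
    using lam_pos[OF i] by (simp add: mult_less_0_iff)
  moreover have "0 \<le> K"
    using L by (simp add: K_def)
  ultimately show ?thesis
    using v by (intro exI[of _ v]) auto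
qed

end

text \<open>
  A simplex with interior points has affinely independent vertices, and its interior consists of
  the points whose barycentric coordinates are all positive.
\<close>
lemma surrounding_family_if_zero_interior:
  fixes x :: "'i \<Rightarrow> 'a::euclidean_space"
  assumes fin: "finite I" and card: "card I = DIM('a) + 1" and inj: "inj_on x I"
    and zero: "0 \<in> interior (convex hull (x ` I))"
  obtains lam where "surrounding_family I x lam" and "sum lam I = 1"
proof -
  have aff: "affine hull (x ` I) = UNIV"
    using affine_hull_nonempty_interior[of "convex hull (x ` I)"] zero by auto
  have cardx: "card (x ` I) = DIM('a) + 1"
    using card inj by (simp add: card_image)
  have "aff_dim (x ` I) = int (card (x ` I)) - 1"
    using aff cardx aff_dim_eq_full[of "x ` I"] by simp
  then have "\<not> affine_dependent (x ` I)"
    using fin by (simp add: affine_independent_iff_card)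
  then obtain u where u: "\<forall>y\<in>x ` I. 0 < u y" "sum u (x ` I) = 1" "(\<Sum>y\<in>x ` I. u y *\<^sub>R y) = 0"
    using zero interior_convex_hull_explicit_minimal[of "x ` I"] cardx by auto
  show ?thesis
  proof
    show "surrounding_family I x (\<lambda>i. u (x i))"
    proof
      show "(\<Sum>i\<in>I. u (x i) *\<^sub>R x i) = 0"
        using u(3) by (simp add: sum.reindex[OF inj])
      show "span (x ` I) = UNIV"
        using aff affine_hull_subset_span[of "x ` I"] by auto
    qed (use fin card u(1) in auto)
    show "(\<Sum>i\<in>I. u (x i)) = 1"
      using u(2) by (simp add: sum.reindex[OF inj])
  qed
qed

section \<open>The set of feasible gradients\<close>

theorem theorem1:
  fixes X :: "(real ^ 'n) set"
    and f :: "real ^ 'n \<Rightarrow> real"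
    and grad :: "real ^ 'n \<Rightarrow> real ^ 'n"
    and x :: "nat \<Rightarrow> real ^ 'n"
    and d :: nat
  assumes "d = CARD('n)"
    and "convex X" and "bounded X"
    and "convex_on X f"
    and "is_gradient_on f grad X"
    and "inj_on x {0..d}" and "x ` {0..d} \<subseteq> X"
    and "0 \<in> interior (convex hull (x ` {0..d}))"
  defines "A \<equiv> feasible_gradients grad x {0..d}"
    and "F \<equiv> feasible_face grad x"
  shows "bounded A \<and> polyhedron A \<and> bounded_by_faces grad x {0..d} A \<and>
    (\<exists>v. (\<forall>i\<in>{0..d}. (\<Inter>j\<in>{0..d} - {i}. F j) = {v i}) \<and>
         A = convex hull (v ` {0..d}))"
proof -
  define b where "b = (\<lambda>i. grad (x i) \<bullet> x i)"
  obtain lam where fam: "surrounding_family {0..d} x lam" and lam_sum: "sum lam {0..d} = 1"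
    using surrounding_family_if_zero_interior[of "{0..d}" x] assms(1,6,8) by auto
  interpret surrounding_family "{0..d}" x lam
    by (rule fam)
  have s: "0 \<le> (\<Sum>i\<in>{0..d}. lam i * b i)"
    unfolding b_def
    using weighted_gradient_sum_nonneg[OF assms(4,2,5) fin assms(7) _ lam_sum relation] lam_pos
    by (simp add: less_imp_le)
  have A_eq: "A = {v. \<forall>i\<in>{0..d}. v \<bullet> x i \<le> b i}"
    by (simp add: A_def feasible_gradients_def b_def)
  have F_eq: "F i = {v. v \<bullet> x i = b i}" for i
    by (simp add: F_def feasible_face_def b_def)
  have hull: "A = convex hull (vertex b ` {0..d})"
    unfolding A_eq by (rule halfspaces_eq_convex_hull_vertex[OF s])
  then have polytope: "polytope A"
    by (simp add: polytope_convex_hull)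
  have faces: "hyperplane (F i) \<and> A \<inter> F i \<noteq> {} \<and> (A \<inter> F i) face_of A \<and>
      feasible_gradients grad x ({0..d} - {i}) \<noteq> A" if i: "i \<in> {0..d}" for i
  proof (intro conjI)
    show "hyperplane (F i)"
      unfolding hyperplane_def F_eq using nonzero[OF i] by blast
    \<comment> \<open>every vertex but the \<open>i\<close>-th lies on the \<open>i\<close>-th hyperplane\<close>
    obtain k where k: "k \<in> {0..d}" "k \<noteq> i"
    proof (cases "i = 0")
      case True
      then show ?thesis using that[of d] assms(1) by simp
    next
      case False
      then show ?thesis using that[of 0] by simp
    qed
    have "vertex b k \<in> A \<inter> F i"
      using vertex_feasible[OF s k(1)] inner_vertex[OF k(1) i] k(2) by (simp add: A_eq F_eq)
    then show "A \<inter> F i \<noteq> {}"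
      by blast
    have F_alt: "F i = {v. x i \<bullet> v = b i}"
      by (simp add: F_eq inner_commute)
    show "(A \<inter> F i) face_of A"
      unfolding F_alt
    proof (rule face_of_Int_supporting_hyperplane_le)
      show "convex A"
        using hull by simp
      show "x i \<bullet> v \<le> b i" if "v \<in> A" for v
        using that i by (simp add: A_eq inner_commute)
    qed
    show "feasible_gradients grad x ({0..d} - {i}) \<noteq> A"
    proof -
      obtain v where v: "\<forall>j\<in>{0..d} - {i}. v \<bullet> x j \<le> b j" "b i < v \<bullet> x i"
        using halfspace_irredundant[OF i, of b] by blast
      have "v \<in> feasible_gradients grad x ({0..d} - {i})"
        using v(1) by (simp add: feasible_gradients_def b_def)
      moreover have "v \<notin> A"
        using v(2) i by (auto simp: A_eq not_le)
      ultimately show ?thesis by blast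
    qed
  qed
  have "bounded_by_faces grad x {0..d} A"
    using faces by (simp add: bounded_by_faces_def A_def F_def)
  moreover have vertices: "(\<Inter>j\<in>{0..d} - {i}. F j) = {vertex b i}" if "i \<in> {0..d}" for i
    unfolding F_eq by (rule Inter_hyperplanes_eq_vertex[OF that])
  ultimately show ?thesis
    using polytope_imp_bounded[OF polytope] polytope_imp_polyhedron[OF polytope] hull vertices
    by (intro conjI exI[of _ "vertex b"] ballI)
qed

end
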